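(* Let $q>1$ be real, $\mathbb{T}=q^{\mathbb{N}_0}=\{q^k:k\in\mathbb{N}_0\}$, and let $m,n\in\mathbb{N}_0$ with $m<n$. Put $a=q^m$, $b=q^n$ and $[a,b]=\{q^k: m\le k\le n\}$. Let $f:[a,b]\to\mathbb{R}$ and let $\gamma,\Gamma\in\mathbb{R}$ satisfy $$\gamma\le\frac{f(qt)-f(t)}{(q-1)t}\le\Gamma\quad\text{for all } t\in[a,b] \text{ with } t<b.$$ Then for all $t\in[a,b]$, $$\left|f(t)-\frac{1}{q^n-q^m}\int_{q^m}^{q^n}f^\sigma(s)\,\Delta s-\frac{f(q^n)-f(q^m)}{q^n-q^m}\left(t-\frac{q^{2n+1}-q^{2m+1}}{(q+1)(q^n-q^m)}\right)\right|\le\frac14(q^n-q^m)(\Gamma-\gamma).$$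
   Context: On $\mathbb{T}=q^{\mathbb{N}_0}$ the forward jump operator is $\sigma(t)=qt$, and $f^\sigma(t)=f(qt)$. The $\Delta$-integral is the time-scale integral $\int_c^d g(s)\,\Delta s=G(d)-G(c)$, where $G$ satisfies $\frac{G(qs)-G(s)}{(q-1)s}=g(s)$; explicitly $\int_{q^m}^{q^n}g(s)\,\Delta s=\sum_{k=m}^{n-1}(q-1)q^k g(q^k)$. *)

theory Defs
  imports Complex_Main
begin

definition q_scale :: "real \<Rightarrow> real set" where
  "q_scale q = {q ^ k | k :: nat. True}"

definition q_interval :: "real \<Rightarrow> nat \<Rightarrow> nat \<Rightarrow> real set" where
  "q_interval q m n = {q ^ k | k. m \<le> k \<and> k \<le> n}"

definition forward_jump :: "real \<Rightarrow> real \<Rightarrow> real" where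
  "forward_jump q t = q * t"

definition delta_deriv :: "real \<Rightarrow> (real \<Rightarrow> real) \<Rightarrow> real \<Rightarrow> real" where
  "delta_deriv q f t = (f (forward_jump q t) - f t) / ((q - 1) * t)"

text \<open>
  The antiderivative equation is only imposed at points of the time scale in \<open>[c, d)\<close>
  (in \<open>[d, c)\<close> when \<open>d < c\<close>), so the integral does not depend on values of
  \<open>g\<close> elsewhere.  For \<open>q > 1\<close> and limits in the time scale the increment is unique.
\<close>

definition delta_antideriv ::
  "real \<Rightarrow> real \<Rightarrow> real \<Rightarrow> (real \<Rightarrow> real) \<Rightarrow> (real \<Rightarrow> real) \<Rightarrow> bool" where
  "delta_antideriv q c d g G \<longleftrightarrow>
     (\<forall>s \<in> q_scale q. min c d \<le> s \<and> s < max c d \<longrightarrow> delta_deriv q G s = g s)"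

definition delta_integral :: "real \<Rightarrow> real \<Rightarrow> real \<Rightarrow> (real \<Rightarrow> real) \<Rightarrow> real" where
  "delta_integral q c d g = (THE I. \<exists>G. delta_antideriv q c d g G \<and> I = G d - G c)"

lemma delta_antideriv_increment:
  assumes q: "q > 1" and mn: "m \<le> n" and G: "delta_antideriv q (q ^ m) (q ^ n) g G"
  shows "G (q ^ n) - G (q ^ m) = (\<Sum>k = m..<n. (q - 1) * q ^ k * g (q ^ k))"
proof -
  have le: "q ^ m \<le> q ^ n"
    using q mn by (simp add: power_increasing)
  have step: "(q - 1) * q ^ k * g (q ^ k) = G (q ^ Suc k) - G (q ^ k)" if "k \<in> {m..<n}" for k
  proof -
    have "q ^ m \<le> q ^ k" "q ^ k < q ^ n"
      using q that by (auto intro: power_increasing power_strict_increasing)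
    then have "delta_deriv q G (q ^ k) = g (q ^ k)"
      using G le unfolding delta_antideriv_def q_scale_def by (auto simp: min_def max_def)
    moreover have "(q - 1) * q ^ k \<noteq> 0"
      using q by simp
    ultimately show ?thesis
      by (simp add: delta_deriv_def forward_jump_def field_simps)
  qed
  have "(\<Sum>k = m..<n. (q - 1) * q ^ k * g (q ^ k)) = (\<Sum>k = m..<n. G (q ^ Suc k) - G (q ^ k))"
    by (rule sum.cong[OF refl step])
  also have "\<dots> = G (q ^ n) - G (q ^ m)"
    by (rule sum_Suc_diff'[OF mn])
  finally show ?thesis ..
qed

lemma delta_antideriv_exists:
  assumes q: "q > 1"
  shows "\<exists>G. delta_antideriv q c d g G"
proof -
  define G where "G s = (\<Sum>j | q ^ j < s. (q - 1) * q ^ j * g (q ^ j))" for s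
  have G_power: "G (q ^ k) = (\<Sum>j<k. (q - 1) * q ^ j * g (q ^ j))" for k
  proof -
    have "{j. q ^ j < q ^ k} = {..<k}"
      using q by auto
    then show ?thesis
      by (simp add: G_def)
  qed
  have "delta_deriv q G (q ^ k) = g (q ^ k)" for k
    using q G_power[of "Suc k"] G_power[of k] by (simp add: delta_deriv_def forward_jump_def)
  then show ?thesis
    unfolding delta_antideriv_def q_scale_def by blast
qed

lemma delta_integral_eq_sum:
  assumes "q > 1" "m \<le> n"
  shows "delta_integral q (q ^ m) (q ^ n) g = (\<Sum>k = m..<n. (q - 1) * q ^ k * g (q ^ k))"
  unfolding delta_integral_def
  using delta_antideriv_exists[OF assms(1), of "q ^ m" "q ^ n" g] delta_antideriv_increment[OF assms]
  by (intro the_equality) metis+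

end

theory Submission
  imports Defs
begin

text \<open>
  Summation by parts gives the Montgomery identity
  \<open>(b - a) f(t) - \<integral> f\<^sup>\<sigma> = \<integral> P(t, s) f\<^sup>\<Delta>(s) \<Delta>s\<close> with the kernel \<open>P(t, s) = s - a\<close> for \<open>s < t\<close> and
  \<open>P(t, s) = s - b\<close> for \<open>s \<ge> t\<close>.  Applied to the identity function it also evaluates the mean
  of \<open>P(t, \<cdot>)\<close>, so the left-hand side of the claim is the covariance of \<open>P(t, \<cdot>)\<close> and
  \<open>f\<^sup>\<Delta>\<close>.  Since \<open>P(t, \<cdot>)\<close> takes values in \<open>[t - b, t - a]\<close>, an interval of length \<open>b - a\<close>, the
  bound is Gruess' inequality.
\<close>

text \<open>Averaging the chord bound gives \<open>(u - l)\<close> times the deviation at most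
  \<open>2 * (u - p) * (p - l)\<close>, which is largest when \<open>p\<close> is the midpoint of
  the range.\<close>

lemma weighted_mean_abs_deviation_le:
  fixes w x :: "'a \<Rightarrow> real"
  assumes w: "\<And>k. k \<in> A \<Longrightarrow> 0 \<le> w k" "sum w A = 1"
    and x: "\<And>k. k \<in> A \<Longrightarrow> l \<le> x k \<and> x k \<le> u"
    and p: "p = (\<Sum>k\<in>A. w k * x k)"
  shows "(\<Sum>k\<in>A. w k * \<bar>x k - p\<bar>) \<le> (u - l) / 2"
proof -
  have pl: "l \<le> p"
    using sum_mono[of A "\<lambda>k. w k * l" "\<lambda>k. w k * x k"] w x
    by (simp add: p mult_left_mono flip: sum_distrib_right)
  have pu: "p \<le> u"
    using sum_mono[of A "\<lambda>k. w k * x k" "\<lambda>k. w k * u"] w x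
    by (simp add: p mult_left_mono flip: sum_distrib_right)
  show ?thesis
  proof (cases "l = u")
    case True
    then have "x k = p" if "k \<in> A" for k
      using x[OF that] pl pu by simp
    then show ?thesis
      using True by simp
  next
    case False
    then have lu: "l < u"
      using pl pu by simp
    \<comment> \<open>\<open>\<bar>x - p\<bar>\<close> is convex in \<open>x\<close>, hence lies below its chord over \<open>[l, u]\<close>.\<close>
    have chord: "(u - l) * \<bar>x k - p\<bar> \<le> (u - x k) * (p - l) + (x k - l) * (u - p)"
      if k: "k \<in> A" for k
    proof -
      have "0 \<le> (u - x k) * (p - l)" "0 \<le> (x k - l) * (u - p)"
        using x[OF k] pl pu by simp_all
      moreover have "(u - l) * (x k - p) = (x k - l) * (u - p) - (u - x k) * (p - l)"
        by (simp add: algebra_simps)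
      moreover have "(u - l) * \<bar>x k - p\<bar> = \<bar>(u - l) * (x k - p)\<bar>"
        using lu by (simp add: abs_mult)
      ultimately show ?thesis
        by linarith
    qed
    have "(u - l) * (\<Sum>k\<in>A. w k * \<bar>x k - p\<bar>) = (\<Sum>k\<in>A. w k * ((u - l) * \<bar>x k - p\<bar>))"
      by (simp add: sum_distrib_left mult.left_commute)
    also have "\<dots> \<le> (\<Sum>k\<in>A. w k * ((u - x k) * (p - l) + (x k - l) * (u - p)))"
      using chord w by (intro sum_mono mult_left_mono) auto
    \<comment> \<open>The chord is affine in \<open>x k\<close>, so its mean depends only on the
      total weight and on \<open>p\<close>.\<close>
    also have "\<dots> = (\<Sum>k\<in>A. w k * (u * (p - l) - l * (u - p)) + w k * x k * (u + l - 2 * p))"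
      by (rule sum.cong) (simp_all add: algebra_simps)
    also have "\<dots> = sum w A * (u * (p - l) - l * (u - p)) + p * (u + l - 2 * p)"
      by (simp add: sum.distrib p flip: sum_distrib_right)
    \<comment> \<open>Completing the square in \<open>2 * (u - p) * (p - l)\<close>.\<close>
    also have "\<dots> = (u - l) * ((u - l) / 2) - (2 * p - u - l)\<^sup>2 / 2"
      by (simp add: w field_simps power2_eq_square)
    also have "\<dots> \<le> (u - l) * ((u - l) / 2)"
      by simp
    finally show ?thesis
      using lu by simp
  qed
qed

text \<open>The deviations \<open>x k - p\<close> have weighted mean zero, so any constant
  \<open>c\<close> may be subtracted from \<open>y\<close> without changing the covariance. With
  \<open>c\<close> the midpoint of \<open>[l', u']\<close>, the second factor is at most half its
  range, and the mean absolute deviation of \<open>x\<close> supplies the other half.\<close>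

lemma gruess_inequality_sum:
  fixes w x y :: "'a \<Rightarrow> real"
  assumes w: "\<And>k. k \<in> A \<Longrightarrow> 0 \<le> w k" "sum w A = 1"
    and x: "\<And>k. k \<in> A \<Longrightarrow> l \<le> x k \<and> x k \<le> u"
    and y: "\<And>k. k \<in> A \<Longrightarrow> l' \<le> y k \<and> y k \<le> u'"
  shows "\<bar>(\<Sum>k\<in>A. w k * x k * y k) - (\<Sum>k\<in>A. w k * x k) * (\<Sum>k\<in>A. w k * y k)\<bar>
    \<le> (u - l) * (u' - l') / 4"
proof -
  define p where "p = (\<Sum>k\<in>A. w k * x k)"
  define c where "c = (l' + u') / 2"
  have "A \<noteq> {}"
    using w(2) by auto
  then have lu': "l' \<le> u'"
    using y by force
  have "(\<Sum>k\<in>A. w k * (x k - p) * (y k - c)) =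
      (\<Sum>k\<in>A. w k * x k * y k - w k * x k * c - p * (w k * y k) + w k * (p * c))"
    by (rule sum.cong) (simp_all add: algebra_simps)
  also have "\<dots> = (\<Sum>k\<in>A. w k * x k * y k) - p * c - p * (\<Sum>k\<in>A. w k * y k) + sum w A * (p * c)"
    by (simp add: sum.distrib sum_subtractf p_def flip: sum_distrib_left sum_distrib_right)
  finally have "\<bar>(\<Sum>k\<in>A. w k * x k * y k) - p * (\<Sum>k\<in>A. w k * y k)\<bar> =
      \<bar>\<Sum>k\<in>A. w k * (x k - p) * (y k - c)\<bar>"
    by (simp add: w)
  also have "\<dots> \<le> (\<Sum>k\<in>A. w k * \<bar>x k - p\<bar> * ((u' - l') / 2))"
  proof (rule order_trans[OF sum_abs sum_mono])
    fix k assume k: "k \<in> A"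
    have "\<bar>y k - c\<bar> \<le> (u' - l') / 2"
      using y[OF k] unfolding c_def abs_le_iff by (auto simp: field_simps)
    then show "\<bar>w k * (x k - p) * (y k - c)\<bar> \<le> w k * \<bar>x k - p\<bar> * ((u' - l') / 2)"
      using w(1)[OF k] by (simp add: abs_mult mult_left_mono del: times_divide_eq_right)
  qed
  also have "\<dots> = (\<Sum>k\<in>A. w k * \<bar>x k - p\<bar>) * ((u' - l') / 2)"
    by (rule sum_distrib_right[symmetric])
  also have "\<dots> \<le> (u - l) / 2 * ((u' - l') / 2)"
    using weighted_mean_abs_deviation_le[OF w x p_def] lu' by (intro mult_right_mono) auto
  finally show ?thesis
    by (simp add: p_def)
qed

text \<open>The constant \<open>c\<close> drops out of the differences of \<open>g\<close> but can
  be chosen to make a boundary term vanish.\<close>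

lemma summation_by_parts_interval:
  fixes g F :: "nat \<Rightarrow> real"
  assumes "i \<le> j"
  shows "(\<Sum>k = i..<j. (g k - c) * (F (Suc k) - F k)) =
    (g j - c) * F j - (g i - c) * F i - (\<Sum>k = i..<j. (g (Suc k) - g k) * F (Suc k))"
  using assms by (induction j rule: dec_induct) (simp_all add: algebra_simps)

lemma delta_integral_delta_deriv:
  assumes "q > 1" "m \<le> n"
  shows "delta_integral q (q ^ m) (q ^ n) (delta_deriv q f) = f (q ^ n) - f (q ^ m)"
  using delta_antideriv_increment[OF assms, of "delta_deriv q f" f]
  by (simp add: delta_integral_eq_sum[OF assms] delta_antideriv_def)

lemma delta_integral_forward_jump:
  assumes "q > 1" "m \<le> n"
  shows "delta_integral q (q ^ m) (q ^ n) (forward_jump q) =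
    (q ^ (2 * n + 1) - q ^ (2 * m + 1)) / (q + 1)"
proof -
  \<comment> \<open>The delta derivative of the square is \<open>(q + 1) * s\<close>, whence the
    factor \<open>q / (q + 1)\<close>.\<close>
  have "delta_deriv q (\<lambda>s. q * s\<^sup>2 / (q + 1)) s = forward_jump q s" if "s \<noteq> 0" for s
    using assms(1) that
    by (simp add: delta_deriv_def forward_jump_def divide_simps) (simp add: algebra_simps power2_eq_square)
  then have "delta_antideriv q (q ^ m) (q ^ n) (forward_jump q) (\<lambda>s. q * s\<^sup>2 / (q + 1))"
    using assms(1) by (auto simp: delta_antideriv_def q_scale_def)
  from delta_antideriv_increment[OF assms this] show ?thesis
    by (simp add: delta_integral_eq_sum[OF assms] diff_divide_distrib power_mult mult.commute
        flip: power_mult)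
qed

definition montgomery_kernel :: "real \<Rightarrow> real \<Rightarrow> real \<Rightarrow> real \<Rightarrow> real" where
  "montgomery_kernel a b t s = (if s < t then s - a else s - b)"

lemma montgomery_identity:
  assumes q: "q > 1" and j: "m \<le> j" "j \<le> n"
  shows "delta_integral q (q ^ m) (q ^ n)
      (\<lambda>s. montgomery_kernel (q ^ m) (q ^ n) (q ^ j) s * delta_deriv q f s) =
    (q ^ n - q ^ m) * f (q ^ j) - delta_integral q (q ^ m) (q ^ n) (\<lambda>s. f (forward_jump q s))"
proof -
  let ?K = "montgomery_kernel (q ^ m) (q ^ n) (q ^ j)"
  let ?F = "\<lambda>k. f (q ^ k)"
  have mn: "m \<le> n"
    using j by simp
  have split: "(\<Sum>k = m..<n. h k) = (\<Sum>k = m..<j. h k) + (\<Sum>k = j..<n. h k)" for h :: "nat \<Rightarrow> real"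
    using sum.atLeastLessThan_concat[OF j, of h] by simp
  have step: "(q - 1) * q ^ k * (z * delta_deriv q f (q ^ k)) = z * (?F (Suc k) - ?F k)" for k z
    using q by (simp add: delta_deriv_def forward_jump_def)
  have "delta_integral q (q ^ m) (q ^ n) (\<lambda>s. ?K s * delta_deriv q f s) =
      (\<Sum>k = m..<n. ?K (q ^ k) * (?F (Suc k) - ?F k))"
    by (simp only: delta_integral_eq_sum[OF q mn] step)
  also have "\<dots> = (\<Sum>k = m..<j. (q ^ k - q ^ m) * (?F (Suc k) - ?F k)) +
      (\<Sum>k = j..<n. (q ^ k - q ^ n) * (?F (Suc k) - ?F k))"
    unfolding split using q
    by (intro arg_cong2[of _ _ _ _ "(+)"] sum.cong) (auto simp: montgomery_kernel_def)
  \<comment> \<open>The boundary terms at \<open>m\<close> and \<open>n\<close> vanish; those at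
    \<open>j\<close> are \<open>(q ^ j - q ^ m) * ?F j\<close> and
    \<open>- (q ^ j - q ^ n) * ?F j\<close>.\<close>
  also have "\<dots> = (q ^ n - q ^ m) * ?F j - (\<Sum>k = m..<n. (q ^ Suc k - q ^ k) * ?F (Suc k))"
    unfolding split summation_by_parts_interval[OF j(1), of "power q" _ ?F]
      summation_by_parts_interval[OF j(2), of "power q" _ ?F]
    by (simp add: algebra_simps)
  also have "(\<Sum>k = m..<n. (q ^ Suc k - q ^ k) * ?F (Suc k)) =
      delta_integral q (q ^ m) (q ^ n) (\<lambda>s. f (forward_jump q s))"
    by (simp add: delta_integral_eq_sum[OF q mn] forward_jump_def algebra_simps)
  finally show ?thesis .
qed

theorem corollary3:
  fixes q \<gamma> \<Gamma> :: real and m n :: nat and f :: "real \<Rightarrow> real"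
  assumes "q > 1" and "m < n"
    and "\<And>t. t \<in> q_interval q m n \<Longrightarrow> t < q ^ n \<Longrightarrow>
           \<gamma> \<le> delta_deriv q f t \<and> delta_deriv q f t \<le> \<Gamma>"
  shows "\<forall>t \<in> q_interval q m n.
    \<bar>f t - 1 / (q ^ n - q ^ m) * delta_integral q (q ^ m) (q ^ n) (\<lambda>s. f (forward_jump q s))
       - (f (q ^ n) - f (q ^ m)) / (q ^ n - q ^ m) *
         (t - (q ^ (2 * n + 1) - q ^ (2 * m + 1)) / ((q + 1) * (q ^ n - q ^ m)))\<bar>
    \<le> 1 / 4 * (q ^ n - q ^ m) * (\<Gamma> - \<gamma>)"
proof
  fix t assume "t \<in> q_interval q m n"
  then obtain j where j: "m \<le> j" "j \<le> n" and t: "t = q ^ j"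
    by (auto simp: q_interval_def)
  let ?I = "delta_integral q (q ^ m) (q ^ n)"
  let ?D = "delta_deriv q f"
  let ?K = "montgomery_kernel (q ^ m) (q ^ n) t"
  define W where "W = q ^ n - q ^ m"
  \<comment> \<open>The step lengths of the time scale, normalised so that \<open>?I g / W\<close>
    is a weighted mean.\<close>
  define w where "w k = (q - 1) * q ^ k / W" for k
  have mn: "m \<le> n"
    using assms(2) by simp
  have W: "W > 0"
    using assms by (simp add: W_def)
  have mean: "(\<Sum>k = m..<n. w k * g (q ^ k)) = ?I g / W" for g
    by (simp add: w_def delta_integral_eq_sum[OF assms(1) mn] sum_divide_distrib)
  have id: "delta_deriv q (\<lambda>s. s) s = 1" if "s \<noteq> 0" for s
    using assms(1) that by (simp add: delta_deriv_def forward_jump_def divide_simps) (simp add: algebra_simps)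
  \<comment> \<open>The constant 1 is the derivative of the identity, so its integral is
    \<open>W\<close>.\<close>
  have "?I (delta_deriv q (\<lambda>s. s)) = ?I (\<lambda>_. 1)"
    using assms(1) by (simp add: delta_integral_eq_sum[OF assms(1) mn] id)
  then have w_sum: "sum w {m..<n} = 1"
    using mean[of "\<lambda>_. 1"] W delta_integral_delta_deriv[OF assms(1) mn, of "\<lambda>s. s"]
    by (simp add: W_def)
  have w_nonneg: "0 \<le> w k" for k
    using assms(1) W by (simp add: w_def)
  \<comment> \<open>The kernel is nonnegative before \<open>t\<close> and nonpositive from
    \<open>t\<close> on. The length of this range does not depend on \<open>t\<close>, so the final
    bound is uniform.\<close>
  have K: "t - q ^ n \<le> ?K (q ^ k) \<and> ?K (q ^ k) \<le> t - q ^ m" if "k \<in> {m..<n}" for k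
  proof -
    have "q ^ m \<le> q ^ k" "q ^ k \<le> q ^ n" "q ^ m \<le> t" "t \<le> q ^ n"
      using assms(1) j that by (auto simp: t)
    then show ?thesis
      by (auto simp: montgomery_kernel_def)
  qed
  have D: "\<gamma> \<le> ?D (q ^ k) \<and> ?D (q ^ k) \<le> \<Gamma>" if "k \<in> {m..<n}" for k
    using assms(1,3) that by (auto simp: q_interval_def)
  have mean_KD: "?I (\<lambda>s. ?K s * ?D s) / W = f t - ?I (\<lambda>s. f (forward_jump q s)) / W"
    using W montgomery_identity[OF assms(1) j, of f] by (simp add: t W_def diff_divide_distrib)
  \<comment> \<open>For the identity function, the integral subtracted in the Montgomery identity is
    that of \<open>forward_jump q\<close>, which is known in closed form.\<close>
  have "?I ?K = ?I (\<lambda>s. ?K s * delta_deriv q (\<lambda>s. s) s)"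
    using assms(1) by (simp add: delta_integral_eq_sum[OF assms(1) mn] id)
  also have "\<dots> = W * t - (q ^ (2 * n + 1) - q ^ (2 * m + 1)) / (q + 1)"
    using montgomery_identity[OF assms(1) j, of "\<lambda>s. s"] delta_integral_forward_jump[OF assms(1) mn]
    by (simp add: t W_def)
  finally have mean_K: "?I ?K / W = t - (q ^ (2 * n + 1) - q ^ (2 * m + 1)) / ((q + 1) * W)"
    using W by (simp add: diff_divide_distrib)
  have "\<bar>?I (\<lambda>s. ?K s * ?D s) / W - ?I ?K / W * (?I ?D / W)\<bar> \<le>
      ((t - q ^ m) - (t - q ^ n)) * (\<Gamma> - \<gamma>) / 4"
    using gruess_inequality_sum[OF w_nonneg w_sum K D] by (simp add: mean mult.assoc flip: mean)
  then show "\<bar>f t - 1 / (q ^ n - q ^ m) * ?I (\<lambda>s. f (forward_jump q s))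
       - (f (q ^ n) - f (q ^ m)) / (q ^ n - q ^ m) *
         (t - (q ^ (2 * n + 1) - q ^ (2 * m + 1)) / ((q + 1) * (q ^ n - q ^ m)))\<bar>
    \<le> 1 / 4 * (q ^ n - q ^ m) * (\<Gamma> - \<gamma>)"
    unfolding mean_KD mean_K delta_integral_delta_deriv[OF assms(1) mn]
    by (simp add: mult.commute flip: W_def)
qed

end
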